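(* Let $X$ be a linear 2-normed space over $\mathbb{K}$ ($\mathbb{K}=\mathbb{R}$ or $\mathbb{C}$) and let $b\in X$ be fixed. Then every continuous b-linear functional defined on $X\times\langle b\rangle$ is b-sequentially continuous.
   Context: Let $X$ be a linear space of dimension greater than $1$ over $\mathbb{K}$. A 2-norm on $X$ is a function $\|\cdot,\cdot\|:X\times X\to\mathbb{R}$ such that: (N1) $\|x,y\|=0$ if and only if $x,y$ are linearly dependent; (N2) $\|x,y\|=\|y,x\|$; (N3) $\|\alpha x,y\|=|\alpha|\,\|x,y\|$ for all $\alpha\in\mathbb{K}$; (N4) $\|x,y+z\|\le\|x,y\|+\|x,z\|$. The pair $(X,\|\cdot,\cdot\|)$ is then called a linear 2-normed space. A sequence $\{x_n\}$ in $X$ converges to $x\in X$ if $\lim_{n\to\infty}\|x_n-x,y\|=0$ for every $y\in X$. For fixed $b\in X$, $\langle b\rangle$ is the subspace of $X$ generated by $b$. A b-linear functional on $X\times\langle b\rangle$ is a map $T:X\times\langle b\rangle\to\mathbb{K}$ with $T(x+y,b)=T(x,b)+T(y,b)$ and $T(kx,b)=kT(x,b)$ for all $x,y\in X$, $k\in\mathbb{K}$. A b-linear functional $T:X\times\langle b\rangle\to\mathbb{K}$ is continuous at $x_0\in X$ if for every $\epsilon>0$ there exist some $e\in X$ and $\delta>0$ such that for all $x\in X$, $\|x-x_0,e\|<\delta$ implies $|T(x,b)-T(x_0,b)|<\epsilon$; it is continuous if it is continuous at every point of $X$. It is b-sequentially continuous at $x\in X$ if for every sequence $\{x_n\}$ converging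 to $x$ in $X$, the sequence $\{T(x_n,b)\}$ converges to $T(x,b)$ in $\mathbb{K}$; it is b-sequentially continuous if this holds at every point of $X$. *)

theory Defs
  imports Complex_Main
begin

(* Linear dependence of the family (x, y). The library's "dependent {x, y}" is about sets:
   for x = y \<noteq> 0 the set {x, y} = {x} is independent although the family (x, x) is dependent. *)
definition linearly_dependent_pair ::
  "('k::field \<Rightarrow> 'a::ab_group_add \<Rightarrow> 'a) \<Rightarrow> 'a \<Rightarrow> 'a \<Rightarrow> bool" where
  "linearly_dependent_pair scale x y \<longleftrightarrow>
     (\<exists>\<alpha> \<beta>. (\<alpha> \<noteq> 0 \<or> \<beta> \<noteq> 0) \<and> scale \<alpha> x + scale \<beta> y = 0)"

(* The scalar field K is a type of class real_normed_field. Both real and complex are instances,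
   and by the Gelfand-Mazur theorem every instance is isometrically isomorphic to one of them.
   The space X is the whole type 'a. Dimension greater than 1 is stated with a Hamel basis because
   the library's dim is 0 on infinite-dimensional spaces. *)
locale linear_2_normed_space = vector_space scale
  for scale :: "'k::real_normed_field \<Rightarrow> 'a::ab_group_add \<Rightarrow> 'a" +
  fixes N :: "'a \<Rightarrow> 'a \<Rightarrow> real"
  assumes dim_gt_1: "\<exists>B. independent B \<and> span B = UNIV \<and> (infinite B \<or> card B > 1)"
    and N1: "N x y = 0 \<longleftrightarrow> linearly_dependent_pair scale x y"
    and N2: "N x y = N y x"
    and N3: "N (scale \<alpha> x) y = norm \<alpha> * N x y"
    and N4: "N x (y + z) \<le> N x y + N x z"

definition converges_2_norm :: "('a::ab_group_add \<Rightarrow> 'a \<Rightarrow> real) \<Rightarrow> (nat \<Rightarrow> 'a) \<Rightarrow> 'a \<Rightarrow> bool" where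
  "converges_2_norm N xs x \<longleftrightarrow> (\<forall>y. (\<lambda>n. N (xs n - x) y) \<longlonglongrightarrow> 0)"

(* A functional on X \<times> <b> is represented by a total function on 'a \<times> 'a. Its values outside
   UNIV \<times> span {b} are arbitrary; this and the following notions only use values at (x, b). *)
definition b_linear_functional ::
  "('k::real_normed_field \<Rightarrow> 'a::ab_group_add \<Rightarrow> 'a) \<Rightarrow> 'a \<Rightarrow> ('a \<times> 'a \<Rightarrow> 'k) \<Rightarrow> bool" where
  "b_linear_functional scale b T \<longleftrightarrow>
     (\<forall>x y. T (x + y, b) = T (x, b) + T (y, b)) \<and>
     (\<forall>k x. T (scale k x, b) = k * T (x, b))"

definition b_continuous_at ::
  "('a::ab_group_add \<Rightarrow> 'a \<Rightarrow> real) \<Rightarrow> 'a \<Rightarrow> ('a \<times> 'a \<Rightarrow> 'k::real_normed_field) \<Rightarrow> 'a \<Rightarrow> bool" where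
  "b_continuous_at N b T x0 \<longleftrightarrow>
     (\<forall>\<epsilon>>0. \<exists>e. \<exists>\<delta>>0. \<forall>x. N (x - x0) e < \<delta> \<longrightarrow> norm (T (x, b) - T (x0, b)) < \<epsilon>)"

definition b_continuous ::
  "('a::ab_group_add \<Rightarrow> 'a \<Rightarrow> real) \<Rightarrow> 'a \<Rightarrow> ('a \<times> 'a \<Rightarrow> 'k::real_normed_field) \<Rightarrow> bool" where
  "b_continuous N b T \<longleftrightarrow> (\<forall>x0. b_continuous_at N b T x0)"

definition b_sequentially_continuous_at ::
  "('a::ab_group_add \<Rightarrow> 'a \<Rightarrow> real) \<Rightarrow> 'a \<Rightarrow> ('a \<times> 'a \<Rightarrow> 'k::real_normed_field) \<Rightarrow> 'a \<Rightarrow> bool" where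
  "b_sequentially_continuous_at N b T x \<longleftrightarrow>
     (\<forall>xs. converges_2_norm N xs x \<longrightarrow> (\<lambda>n. T (xs n, b)) \<longlonglongrightarrow> T (x, b))"

definition b_sequentially_continuous ::
  "('a::ab_group_add \<Rightarrow> 'a \<Rightarrow> real) \<Rightarrow> 'a \<Rightarrow> ('a \<times> 'a \<Rightarrow> 'k::real_normed_field) \<Rightarrow> bool" where
  "b_sequentially_continuous N b T \<longleftrightarrow> (\<forall>x. b_sequentially_continuous_at N b T x)"

end

theory Submission
  imports Defs
begin

text \<open>Continuity at \<open>x\<close> controls \<open>T\<close> near \<open>x\<close> through
  one seminorm \<open>N (_ - x) e\<close>, whose direction \<open>e\<close> may change with
  \<epsilon>. Convergence in the 2-norm is convergence in all these seminorms, so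
  \<open>xs n\<close> eventually enters the \<delta>-ball for whichever \<open>e\<close> continuity
  supplies.\<close>

theorem theorem4p7:
  fixes scale :: "'k::real_normed_field \<Rightarrow> 'a::ab_group_add \<Rightarrow> 'a"
    and N :: "'a \<Rightarrow> 'a \<Rightarrow> real"
    and b :: 'a
    and T :: "'a \<times> 'a \<Rightarrow> 'k"
  assumes "linear_2_normed_space scale N"
    and "b_linear_functional scale b T"
    and "b_continuous N b T"
  shows "b_sequentially_continuous N b T"
proof -
  have "(\<lambda>n. T (xs n, b)) \<longlonglongrightarrow> T (x, b)" if conv: "converges_2_norm N xs x" for xs x
  proof (rule tendstoI)
    fix \<epsilon> :: real
    assume "\<epsilon> > 0"
    then obtain e \<delta> where "\<delta> > 0"
      and \<delta>: "\<And>z. N (z - x) e < \<delta> \<Longrightarrow> norm (T (z, b) - T (x, b)) < \<epsilon>"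
      using assms(3) unfolding b_continuous_def b_continuous_at_def by meson
    \<comment> \<open>Since \<open>e\<close> depends on \<epsilon>, the direction is chosen only
      here, with \<epsilon> already fixed.\<close>
    have "(\<lambda>n. N (xs n - x) e) \<longlonglongrightarrow> 0"
      using conv unfolding converges_2_norm_def by blast
    \<comment> \<open>Continuity asks only for an upper bound on \<open>N\<close>, which is the half
      of order convergence that 0 < \<delta> yields.\<close>
    then have "\<forall>\<^sub>F n in sequentially. N (xs n - x) e < \<delta>"
      using \<open>\<delta> > 0\<close> by (rule order_tendstoD)
    then show "\<forall>\<^sub>F n in sequentially. dist (T (xs n, b)) (T (x, b)) < \<epsilon>"
      by (rule eventually_mono) (simp add: dist_norm \<delta>)
  qed
  then show ?thesis
    unfolding b_sequentially_continuous_def b_sequentially_continuous_at_def by blast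
qed

end
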